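(* Let $k\geqslant 2$ be an integer and let $F_1(z),\ldots,F_d(z)\in\mathbb{C}[[z]]$ be $k$-Mahler functions, each convergent in the open unit disc, for which the eigenvalues $\lambda_{F_1},\ldots,\lambda_{F_d}$ exist. Let $\mathcal{M}$ denote the set of meromorphic functions on $\mathbb{C}$. If the numbers $k,\lambda_{F_1},\ldots,\lambda_{F_d}$ are multiplicatively independent, then $$\operatorname{trdeg}_{\mathbb{C}(z)(\mathcal{M})}\mathbb{C}(z)(\mathcal{M})(F_1(z),\ldots,F_d(z))=d.$$ In particular, $F_1(z),\ldots,F_d(z)$ are algebraically independent over $\mathbb{C}(z)$.
   Context: A power series $F(z)\in\mathbb{C}[[z]]$ is $k$-Mahler if there exist an integer $d\geqslant 1$ and polynomials $a_0(z),\ldots,a_d(z)\in\mathbb{C}[z]$, not all zero, with $a_0(z)F(z)+a_1(z)F(z^k)+\cdots+a_d(z)F(z^{k^d})=0$; the minimal such $d$ is the degree of $F$. For such an equation of minimal degree $d$, the characteristic polynomial is $p_F(\lambda)=a_0(1)\lambda^d+a_1(1)\lambda^{d-1}+\cdots+a_d(1)$. When $p_F$ has $d$ distinct roots, there is a root $\lambda_F$ of $p_F$ (the eigenvalue of $F$) such that as $z\to1^-$, $F(z)=C_F(z)(1-z)^{-\log_k\lambda_F}(1+o(1))$, where $\log_k$ is the principal base-$k$ logarithm and $C_F$ is a real-analytic nonzero function which on $(0,1)$ is bounded away from $0$ and $\infty$ and satisfies $C_F(z)=C_F(z^k)$. "The eigenvalue $\lambda_F$ exists" means this situation holds. Complex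 numbers $x_0,\ldots,x_d$ are multiplicatively independent if $x_0^{e_0}\cdots x_d^{e_d}=1$ with integers $e_i$ implies all $e_i=0$. $\mathbb{C}(z)(\mathcal{M})$ is the field generated over $\mathbb{C}(z)$ by all meromorphic functions on $\mathbb{C}$. *)

theory Defs
  imports
    "HOL-Complex_Analysis.Complex_Analysis"
    "HOL-Library.Poly_Mapping"
    "HOL-Library.Landau_Symbols"
    "HOL-Library.Extended_Nat"
begin

definition is_subfield :: "'a::field set \<Rightarrow> bool" where
  "is_subfield K \<longleftrightarrow> 0 \<in> K \<and> 1 \<in> K \<and>
     (\<forall>x\<in>K. \<forall>y\<in>K. x + y \<in> K \<and> x * y \<in> K) \<and> (\<forall>x\<in>K. - x \<in> K \<and> inverse x \<in> K)"

definition field_adjoin :: "'a::field set \<Rightarrow> 'a set \<Rightarrow> 'a set" where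
  "field_adjoin K S = \<Inter> {L. is_subfield L \<and> K \<union> S \<subseteq> L}"

(* A polynomial in the variables X_i (i :: 'i) is a finitely supported map from monomials to
   coefficients, a monomial being a finitely supported map from variables to exponents. *)
definition mpoly_eval :: "('i \<Rightarrow> 'a) \<Rightarrow> (('i \<Rightarrow>\<^sub>0 nat) \<Rightarrow>\<^sub>0 'a) \<Rightarrow> 'a::comm_ring_1" where
  "mpoly_eval x p =
     (\<Sum>m\<in>Poly_Mapping.keys p. Poly_Mapping.lookup p m *
        (\<Prod>i\<in>Poly_Mapping.keys m. x i ^ Poly_Mapping.lookup m i))"

definition algebraically_independent :: "'a::field set \<Rightarrow> 'i set \<Rightarrow> ('i \<Rightarrow> 'a) \<Rightarrow> bool" where
  "algebraically_independent K I x \<longleftrightarrow>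
     (\<forall>p. (\<forall>m. Poly_Mapping.lookup p m \<in> K) \<and>
          (\<forall>m\<in>Poly_Mapping.keys p. Poly_Mapping.keys m \<subseteq> I) \<and>
          mpoly_eval x p = 0 \<longrightarrow> p = 0)"

(* The largest cardinality of a subset of L that is algebraically independent over K;
   infinite transcendence degrees are not distinguished from each other. *)
definition transcendence_degree :: "'a::field set \<Rightarrow> 'a set \<Rightarrow> enat" where
  "transcendence_degree K L =
     (SUP B \<in> {B. finite B \<and> B \<subseteq> L \<and> algebraically_independent K B (\<lambda>b. b)}. enat (card B))"

definition multiplicatively_independent :: "'i set \<Rightarrow> ('i \<Rightarrow> complex) \<Rightarrow> bool" where
  "multiplicatively_independent I x \<longleftrightarrow>
     (\<forall>e :: 'i \<Rightarrow> int. (\<Prod>i\<in>I. x i powi e i) = 1 \<longrightarrow> (\<forall>i\<in>I. e i = 0))"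

(* All fields are realised inside the field of formal Laurent series at 0; functions meromorphic
   on the whole plane are determined by their Laurent expansions there. *)
definition rational_fls :: "complex fls set" where
  "rational_fls = {fps_to_fls (fps_of_poly p) / fps_to_fls (fps_of_poly q) | p q. q \<noteq> 0}"

definition meromorphic_fls :: "complex fls set" where
  "meromorphic_fls = {L. \<exists>f. f meromorphic_on UNIV \<and> f has_laurent_expansion L}"

definition mahler_equation :: "nat \<Rightarrow> complex fps \<Rightarrow> nat \<Rightarrow> (nat \<Rightarrow> complex poly) \<Rightarrow> bool" where
  "mahler_equation k F d a \<longleftrightarrow>
     (\<exists>i\<le>d. a i \<noteq> 0) \<and> (\<Sum>i\<le>d. fps_of_poly (a i) * (F oo fps_X ^ (k ^ i))) = 0"

definition is_mahler :: "nat \<Rightarrow> complex fps \<Rightarrow> bool" where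
  "is_mahler k F \<longleftrightarrow> (\<exists>d\<ge>1. \<exists>a. mahler_equation k F d a)"

definition mahler_degree :: "nat \<Rightarrow> complex fps \<Rightarrow> nat" where
  "mahler_degree k F = (LEAST d. d \<ge> 1 \<and> (\<exists>a. mahler_equation k F d a))"

definition mahler_char_poly :: "nat \<Rightarrow> (nat \<Rightarrow> complex poly) \<Rightarrow> complex poly" where
  "mahler_char_poly d a = (\<Sum>i\<le>d. monom (poly (a i) 1) (d - i))"

definition real_analytic_on :: "(real \<Rightarrow> complex) \<Rightarrow> real set \<Rightarrow> bool" where
  "real_analytic_on f S \<longleftrightarrow>
     (\<forall>x\<in>S. \<exists>r>0. \<exists>a. \<forall>y. \<bar>y - x\<bar> < r \<longrightarrow> (\<lambda>n. a n * of_real (y - x) ^ n) sums f y)"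

(* The minimal equation is only determined up to a factor in the field of rational functions,
   hence the quantifier over a. The eigenvalue is unique: the asymptotics force
   F(x^k) / F(x) to converge to 1 / lam as x tends to 1 from the left. The condition that lam
   be nonzero is needed for the principal logarithm to be defined. *)
definition is_mahler_eigenvalue :: "nat \<Rightarrow> complex fps \<Rightarrow> complex \<Rightarrow> bool" where
  "is_mahler_eigenvalue k F lam \<longleftrightarrow>
     (\<exists>a. mahler_equation k F (mahler_degree k F) a \<and>
          card {z. poly (mahler_char_poly (mahler_degree k F) a) z = 0} = mahler_degree k F \<and>
          poly (mahler_char_poly (mahler_degree k F) a) lam = 0) \<and>
     lam \<noteq> 0 \<and>
     (\<exists>C :: real \<Rightarrow> complex.
        real_analytic_on C {0<..<1} \<and>
        (\<exists>b B. 0 < b \<and> (\<forall>x\<in>{0<..<1}. b \<le> norm (C x) \<and> norm (C x) \<le> B)) \<and>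
        (\<forall>x\<in>{0<..<1}. C x = C (x ^ k)) \<and>
        (\<lambda>x. eval_fps F (of_real x)) \<sim>[at_left 1]
          (\<lambda>x. C x * of_real (1 - x) powr (- (Ln lam / of_real (ln (real k))))))"

end

theory Submission
  imports Defs
begin

text \<open>
  Suppose \<open>\<Sum>m. c\<^sub>m F\<^sup>m = 0\<close> with nonzero meromorphic coefficients. By the identity theorem the relation holds
  pointwise on \<open>(0, 1)\<close> near \<open>1\<close>. Since \<open>C\<^sub>F(x) = C\<^sub>F(x\<^sup>k)\<close>, the quotient \<open>F\<^sub>i(x\<^sup>k) / F\<^sub>i(x)\<close> tends to
  \<open>1 / \<lambda>\<^sub>i\<close> as \<open>x\<close> tends to \<open>1\<close> from the left, while \<open>c\<^sub>m(x\<^sup>k) / c\<^sub>m(x)\<close> tends to an integer power of \<open>k\<close>. So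
  each term of the relation is asymptotically an eigenvector of \<open>x \<mapsto> x\<^sup>k\<close>, and multiplicative independence makes the
  eigenvalues distinct; as for ordinary eigenvectors, such terms cannot sum to zero. The upper bound
  on the transcendence degree is a dimension count.
\<close>

subsection \<open>Transcendence degree of finitely generated extensions\<close>

lemma subfieldD:
  assumes "is_subfield K"
  shows subfield_0: "0 \<in> K" and subfield_1: "1 \<in> K"
    and subfield_add: "\<And>x y. x \<in> K \<Longrightarrow> y \<in> K \<Longrightarrow> x + y \<in> K"
    and subfield_mult: "\<And>x y. x \<in> K \<Longrightarrow> y \<in> K \<Longrightarrow> x * y \<in> K"
    and subfield_uminus: "\<And>x. x \<in> K \<Longrightarrow> - x \<in> K"
    and subfield_inverse: "\<And>x. x \<in> K \<Longrightarrow> inverse x \<in> K"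
  using assms by (auto simp: is_subfield_def)

lemma subfield_diff: "is_subfield K \<Longrightarrow> x \<in> K \<Longrightarrow> y \<in> K \<Longrightarrow> x - y \<in> K"
  using subfield_add[of K x "- y"] subfield_uminus[of K y] by simp

lemma subfield_divide: "is_subfield K \<Longrightarrow> x \<in> K \<Longrightarrow> y \<in> K \<Longrightarrow> x / y \<in> K"
  by (simp add: divide_inverse subfield_mult subfield_inverse)

lemma subfield_sum: "is_subfield K \<Longrightarrow> (\<And>i. i \<in> A \<Longrightarrow> f i \<in> K) \<Longrightarrow> sum f A \<in> K"
  by (induction A rule: infinite_finite_induct) (auto simp: subfield_0 subfield_add)

lemma field_adjoin_minimal: "is_subfield L \<Longrightarrow> K \<subseteq> L \<Longrightarrow> S \<subseteq> L \<Longrightarrow> field_adjoin K S \<subseteq> L"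
  unfolding field_adjoin_def by blast

lemma field_adjoin_superset: "K \<subseteq> field_adjoin K S" "S \<subseteq> field_adjoin K S"
  unfolding field_adjoin_def by blast+

text \<open>Gaussian elimination, by induction on the number of equations: an unknown with a nonzero
  coefficient in the new equation is solved for and substituted into the others. The solution has to
  lie in \<open>K\<close>, not just in the ambient field, because it later supplies the coefficients
  of a polynomial over \<open>K\<close>.\<close>

lemma homogeneous_system_nontrivial_solution:
  fixes c :: "'j \<Rightarrow> 's \<Rightarrow> 'a :: field"
  assumes K: "is_subfield K" and "finite S"
  shows "finite J \<Longrightarrow> card S < card J \<Longrightarrow> (\<And>j s. j \<in> J \<Longrightarrow> s \<in> S \<Longrightarrow> c j s \<in> K) \<Longrightarrow>
    \<exists>a. (\<forall>j\<in>J. a j \<in> K) \<and> (\<exists>j\<in>J. a j \<noteq> 0) \<and> (\<forall>s\<in>S. (\<Sum>j\<in>J. a j * c j s) = 0)"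
  using \<open>finite S\<close>
proof (induction S arbitrary: J c rule: finite_induct)
  case empty
  then have "J \<noteq> {}" by auto
  then show ?case
    by (intro exI[of _ "\<lambda>_. 1"]) (auto simp: subfield_1[OF K])
next
  case (insert t S)
  show ?case
  proof (cases "\<forall>j\<in>J. c j t = 0")
    case True
    obtain a where "\<forall>j\<in>J. a j \<in> K" "\<exists>j\<in>J. a j \<noteq> 0" "\<forall>s\<in>S. (\<Sum>j\<in>J. a j * c j s) = 0"
      using insert.IH[of J c] insert.prems insert.hyps by auto
    with True show ?thesis by (intro exI[of _ a]) auto
  next
    case False
    then obtain i where i: "i \<in> J" "c i t \<noteq> 0" by auto
    \<comment> \<open>Coefficients of the remaining unknowns after \<open>i\<close> has been
      eliminated by means of equation \<open>t\<close>.\<close>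
    define c' where "c' j s = c j s - c j t / c i t * c i s" for j s
    have "c' j s \<in> K" if "j \<in> J - {i}" "s \<in> S" for j s
      unfolding c'_def using that insert.prems(3) i(1)
      by (intro subfield_diff subfield_mult subfield_divide K) auto
    moreover have "card S < card (J - {i})"
      using insert.prems insert.hyps i by (simp add: card_Diff_singleton)
    ultimately obtain a where a: "\<forall>j\<in>J - {i}. a j \<in> K" "\<exists>j\<in>J - {i}. a j \<noteq> 0"
      "\<forall>s\<in>S. (\<Sum>j\<in>J - {i}. a j * c' j s) = 0"
      using insert.IH[of "J - {i}" c'] insert.prems(1) by auto
    \<comment> \<open>The value at \<open>i\<close> is the one that equation \<open>t\<close> forces
      once the other unknowns are given by \<open>a\<close>.\<close>
    define b where "b = a(i := - (\<Sum>j\<in>J - {i}. a j * c j t) / c i t)"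
    have sum_b: "(\<Sum>j\<in>J. b j * c j s) = (\<Sum>j\<in>J - {i}. a j * c' j s)" for s
    proof -
      have "(\<Sum>j\<in>J. b j * c j s) = b i * c i s + (\<Sum>j\<in>J - {i}. b j * c j s)"
        using i insert.prems(1) by (simp add: sum.remove)
      also have "(\<Sum>j\<in>J - {i}. b j * c j s) = (\<Sum>j\<in>J - {i}. a j * c j s)"
        by (intro sum.cong) (auto simp: b_def)
      finally show ?thesis
        by (simp add: b_def c'_def algebra_simps sum_subtractf sum_distrib_left sum_divide_distrib)
    qed
    have "c' j t = 0" for j
      using i by (simp add: c'_def)
    then have "\<forall>s\<in>insert t S. (\<Sum>j\<in>J. b j * c j s) = 0"
      using a(3) by (auto simp: sum_b)
    moreover have "b j \<in> K" if "j \<in> J" for j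
      using that a(1) i insert.prems(3)
      by (auto simp: b_def intro!: subfield_divide subfield_uminus subfield_sum subfield_mult K)
    moreover have "\<exists>j\<in>J. b j \<noteq> 0"
      using a(2) by (auto simp: b_def)
    ultimately show ?thesis by blast
  qed
qed

text \<open>Meant for finite \<open>S\<close>, whose elements serve both as vectors and as indices.
  Requiring \<open>c s \<in> K\<close> for every \<open>s\<close> lets coefficient functions be
  combined without side conditions.\<close>

definition subfield_span :: "'a::field set \<Rightarrow> 'a set \<Rightarrow> 'a set" where
  "subfield_span K S = {\<Sum>s\<in>S. c s * s | c. \<forall>s. c s \<in> K}"

lemma subfield_span_0: "is_subfield K \<Longrightarrow> 0 \<in> subfield_span K S"
  unfolding subfield_span_def by (auto intro!: exI[of _ "\<lambda>_. 0"] simp: subfield_0)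

lemma subfield_span_add:
  assumes "is_subfield K" "x \<in> subfield_span K S" "y \<in> subfield_span K S"
  shows "x + y \<in> subfield_span K S"
proof -
  obtain c e where "x = (\<Sum>s\<in>S. c s * s)" "\<forall>s. c s \<in> K" "y = (\<Sum>s\<in>S. e s * s)" "\<forall>s. e s \<in> K"
    using assms(2,3) by (auto simp: subfield_span_def)
  then show ?thesis unfolding subfield_span_def
    by (auto intro!: exI[of _ "\<lambda>s. c s + e s"] simp: sum.distrib algebra_simps subfield_add[OF assms(1)])
qed

lemma subfield_span_scale:
  assumes "is_subfield K" "x \<in> subfield_span K S" "a \<in> K"
  shows "a * x \<in> subfield_span K S"
proof -
  obtain c where "x = (\<Sum>s\<in>S. c s * s)" "\<forall>s. c s \<in> K"
    using assms(2) by (auto simp: subfield_span_def)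
  then show ?thesis unfolding subfield_span_def
    by (auto intro!: exI[of _ "\<lambda>s. a * c s"] simp: sum_distrib_left mult_ac
        subfield_mult[OF assms(1) \<open>a \<in> K\<close>])
qed

lemma subfield_span_sum:
  "is_subfield K \<Longrightarrow> (\<And>i. i \<in> A \<Longrightarrow> f i \<in> subfield_span K S) \<Longrightarrow> sum f A \<in> subfield_span K S"
  by (induction A rule: infinite_finite_induct) (auto simp: subfield_span_0 subfield_span_add)

lemma subfield_span_base:
  assumes "is_subfield K" "finite S" "s \<in> S"
  shows "s \<in> subfield_span K S"
proof -
  have "s = (\<Sum>t\<in>S. (if t = s then 1 else 0) * t)"
    using assms by (simp add: if_distrib[of "\<lambda>x. x * _"] cong: if_cong)
  then show ?thesis unfolding subfield_span_def
    using assms(1) by (auto intro!: exI[of _ "\<lambda>t. if t = s then 1 else 0"] simp: subfield_0 subfield_1)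
qed

lemma subfield_span_mult:
  assumes K: "is_subfield K" and "finite U" and ST: "\<And>s t. s \<in> S \<Longrightarrow> t \<in> T \<Longrightarrow> s * t \<in> U"
    and x: "x \<in> subfield_span K S" and y: "y \<in> subfield_span K T"
  shows "x * y \<in> subfield_span K U"
proof -
  obtain c e where c: "x = (\<Sum>s\<in>S. c s * s)" "\<forall>s. c s \<in> K" and e: "y = (\<Sum>t\<in>T. e t * t)" "\<forall>t. e t \<in> K"
    using x y by (auto simp: subfield_span_def)
  have "x * y = (\<Sum>s\<in>S. \<Sum>t\<in>T. (c s * e t) * (s * t))"
    by (simp add: c e sum_product mult_ac)
  also have "\<dots> \<in> subfield_span K U"
    using c e by (intro subfield_span_sum subfield_span_scale subfield_span_base subfield_mult K assms(2) ST) auto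
  finally show ?thesis .
qed

lemma subfield_span_mono:
  assumes "is_subfield K" "finite T" "S \<subseteq> T"
  shows "subfield_span K S \<subseteq> subfield_span K T"
proof
  fix x
  assume "x \<in> subfield_span K S"
  then obtain c where "x = (\<Sum>s\<in>S. c s * s)" "\<forall>s. c s \<in> K"
    by (auto simp: subfield_span_def)
  then show "x \<in> subfield_span K T"
    using assms by (auto intro!: subfield_span_sum subfield_span_scale[OF _ subfield_span_base])
qed

section \<open>Polynomial values of bounded degree in each variable\<close>

definition bounded_monomials :: "'i set \<Rightarrow> ('i \<Rightarrow> 'a::field) \<Rightarrow> nat \<Rightarrow> 'a set" where
  "bounded_monomials I x D = (\<lambda>m. \<Prod>i\<in>I. x i ^ m i) ` (I \<rightarrow>\<^sub>E {..D})"

lemma finite_bounded_monomials: "finite I \<Longrightarrow> finite (bounded_monomials I x D)"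
  unfolding bounded_monomials_def by (intro finite_imageI finite_PiE) auto

lemma card_bounded_monomials: "finite I \<Longrightarrow> card (bounded_monomials I x D) \<le> (D + 1) ^ card I"
  unfolding bounded_monomials_def
  by (rule order.trans[OF card_image_le]) (auto simp: card_PiE intro: finite_PiE)

lemma bounded_monomialsI: "(\<And>i. i \<in> I \<Longrightarrow> m i \<le> D) \<Longrightarrow> (\<Prod>i\<in>I. x i ^ m i) \<in> bounded_monomials I x D"
  unfolding bounded_monomials_def
  by (rule image_eqI[of _ _ "restrict m I"]) (auto intro!: prod.cong)

lemma bounded_monomials_mult:
  assumes "s \<in> bounded_monomials I x D" "t \<in> bounded_monomials I x E"
  shows "s * t \<in> bounded_monomials I x (D + E)"
proof -
  obtain m n where "m \<in> I \<rightarrow>\<^sub>E {..D}" "n \<in> I \<rightarrow>\<^sub>E {..E}"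
    "s = (\<Prod>i\<in>I. x i ^ m i)" "t = (\<Prod>i\<in>I. x i ^ n i)"
    using assms by (auto simp: bounded_monomials_def)
  then show ?thesis
    using bounded_monomialsI[of I "\<lambda>i. m i + n i" "D + E" x]
    by (force simp: prod.distrib power_add intro: add_mono)
qed

text \<open>Values at \<open>x\<close> of polynomials over \<open>K\<close> whose degree in each
  variable separately is at most \<open>D\<close>. Bounding the variables separately makes the
  dimension bound \<open>(D + 1) ^ card I\<close> immediate and makes degrees add under
  multiplication. Nothing is assumed about algebraic relations among the \<open>x i\<close>.\<close>

definition bounded_polys :: "'a::field set \<Rightarrow> 'i set \<Rightarrow> ('i \<Rightarrow> 'a) \<Rightarrow> nat \<Rightarrow> 'a set" where
  "bounded_polys K I x D = subfield_span K (bounded_monomials I x D)"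

context
  fixes K :: "'a::field set" and I :: "'i set" and x :: "'i \<Rightarrow> 'a"
  assumes K: "is_subfield K" and fin: "finite I"
begin

lemma bounded_polys_mono:
  assumes "D \<le> E"
  shows "bounded_polys K I x D \<subseteq> bounded_polys K I x E"
  unfolding bounded_polys_def
  using assms by (intro subfield_span_mono K finite_bounded_monomials fin)
    (force simp: bounded_monomials_def[of _ _ D] intro: bounded_monomialsI)

lemma bounded_polys_mult:
  "p \<in> bounded_polys K I x D \<Longrightarrow> q \<in> bounded_polys K I x E \<Longrightarrow> p * q \<in> bounded_polys K I x (D + E)"
  unfolding bounded_polys_def
  by (rule subfield_span_mult[OF K finite_bounded_monomials[OF fin] bounded_monomials_mult])

lemma bounded_polys_const: "a \<in> K \<Longrightarrow> a \<in> bounded_polys K I x D"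
  using subfield_span_scale[OF K subfield_span_base[OF K finite_bounded_monomials[OF fin]
      bounded_monomialsI[of I "\<lambda>_. 0" D x]], of a]
  by (simp add: bounded_polys_def)

lemma bounded_polys_1: "1 \<in> bounded_polys K I x D"
  by (intro bounded_polys_const subfield_1 K)

lemma bounded_polys_power: "p \<in> bounded_polys K I x D \<Longrightarrow> p ^ n \<in> bounded_polys K I x (n * D)"
  by (induction n) (auto intro!: bounded_polys_1 bounded_polys_mult)

lemma bounded_polys_prod:
  "(\<And>b. b \<in> B \<Longrightarrow> f b \<in> bounded_polys K I x D) \<Longrightarrow> prod f B \<in> bounded_polys K I x (card B * D)"
  by (induction B rule: infinite_finite_induct)
    (auto intro!: bounded_polys_1 bounded_polys_mult)

lemma bounded_polys_var: "i \<in> I \<Longrightarrow> x i \<in> bounded_polys K I x 1"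
  using subfield_span_base[OF K finite_bounded_monomials[OF fin]
      bounded_monomialsI[of I "\<lambda>j. if j = i then 1 else 0" 1 x]] fin
  by (simp add: bounded_polys_def if_distrib[of "\<lambda>n. _ ^ n"] prod.delta cong: if_cong)

text \<open>Since \<open>field_adjoin\<close> is the least subfield containing \<open>K\<close> and
  the generators, this shows that each of its elements is a quotient of two polynomial
  values.\<close>

lemma bounded_polys_fractions_subfield:
  "is_subfield {p / q | p q. q \<noteq> 0 \<and> (\<exists>D. p \<in> bounded_polys K I x D \<and> q \<in> bounded_polys K I x D)}"
    (is "is_subfield ?L")
proof -
  \<comment> \<open>Numerator and denominator may come with different degree bounds;
    \<open>D + E\<close> serves for both.\<close>
  have I: "p / q \<in> ?L" if "q \<noteq> 0" "p \<in> bounded_polys K I x D" "q \<in> bounded_polys K I x E" for p q D E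
  proof -
    have "p \<in> bounded_polys K I x (D + E)" "q \<in> bounded_polys K I x (D + E)"
      using that bounded_polys_mono[of D "D + E"] bounded_polys_mono[of E "D + E"] by auto
    with that show ?thesis by blast
  qed
  have K1: "1 \<in> bounded_polys K I x 0" and K0: "0 \<in> bounded_polys K I x 0"
    by (intro bounded_polys_1 bounded_polys_const subfield_0 K)+
  have uminus: "- p \<in> bounded_polys K I x D" if "p \<in> bounded_polys K I x D" for p D
    using bounded_polys_mult[OF bounded_polys_const[of "- 1" 0] that] K
    by (simp add: subfield_uminus subfield_1)
  have add: "p + q \<in> bounded_polys K I x (D + E)"
    if "p \<in> bounded_polys K I x D" "q \<in> bounded_polys K I x E" for p q D E
    using that bounded_polys_mono[of D "D + E"] bounded_polys_mono[of E "D + E"]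
    unfolding bounded_polys_def by (auto intro!: subfield_span_add K)
  have "u + v \<in> ?L \<and> u * v \<in> ?L" if uv: "u \<in> ?L" "v \<in> ?L" for u v
  proof -
    obtain p q D where u: "u = p / q" "q \<noteq> 0" "p \<in> bounded_polys K I x D" "q \<in> bounded_polys K I x D"
      using uv(1) by blast
    obtain r s E where v: "v = r / s" "s \<noteq> 0" "r \<in> bounded_polys K I x E" "s \<in> bounded_polys K I x E"
      using uv(2) by blast
    have "u + v = (p * s + r * q) / (q * s)" "u * v = (p * r) / (q * s)"
      using u v by (auto simp: field_simps)
    moreover have "(p * s + r * q) / (q * s) \<in> ?L"
      using u v by (intro I[OF _ add[OF bounded_polys_mult bounded_polys_mult] bounded_polys_mult]) auto
    moreover have "(p * r) / (q * s) \<in> ?L"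
      using u v by (intro I[OF _ bounded_polys_mult bounded_polys_mult]) auto
    ultimately show ?thesis by simp
  qed
  moreover have "- u \<in> ?L \<and> inverse u \<in> ?L" if uv: "u \<in> ?L" for u
  proof -
    obtain p q D where u: "u = p / q" "q \<noteq> 0" "p \<in> bounded_polys K I x D" "q \<in> bounded_polys K I x D"
      using uv by blast
    have "- u = (- p) / q"
      using u by simp
    moreover have "(- p) / q \<in> ?L"
      using u by (intro I[OF _ uminus]) auto
    moreover have "inverse u \<in> ?L"
    proof (cases "p = 0")
      case True
      then show ?thesis using u I[OF _ K0 K1] by simp
    next
      case False
      then show ?thesis using u I[OF False u(4) u(3)] by (simp add: inverse_eq_divide)
    qed
    ultimately show ?thesis by simp
  qed
  moreover have "0 \<in> ?L" "1 \<in> ?L"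
    using I[OF _ K0 K1] I[OF _ K1 K1] by auto
  ultimately show ?thesis
    unfolding is_subfield_def by blast
qed

text \<open>Each element of the generated field is a quotient of polynomial values, so the product
  of the finitely many denominators clears all of them. The degree bounds add up along the
  induction.\<close>

lemma field_adjoin_common_denominator:
  assumes "finite B" "B \<subseteq> field_adjoin K (x ` I)"
  shows "\<exists>q D. q \<noteq> 0 \<and> q \<in> bounded_polys K I x D \<and> (\<forall>b\<in>B. q * b \<in> bounded_polys K I x D)"
  using assms
proof (induction B rule: finite_induct)
  case empty
  then show ?case by (intro exI[of _ 1]) (auto intro!: bounded_polys_1)
next
  case (insert b B)
  let ?L = "{p / q | p q. q \<noteq> 0 \<and> (\<exists>D. p \<in> bounded_polys K I x D \<and> q \<in> bounded_polys K I x D)}"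
  obtain q D where q: "q \<noteq> 0" "q \<in> bounded_polys K I x D" "\<forall>b\<in>B. q * b \<in> bounded_polys K I x D"
    using insert by auto
  have L: "a \<in> ?L" if "a \<in> bounded_polys K I x E" for a E
    by (rule CollectI, rule exI[of _ a], rule exI[of _ 1]) (use that in \<open>auto intro: bounded_polys_1\<close>)
  have "K \<subseteq> ?L"
    using L[OF bounded_polys_const] by blast
  moreover have "x ` I \<subseteq> ?L"
    using L[OF bounded_polys_var] by blast
  ultimately have "b \<in> ?L"
    using field_adjoin_minimal[OF bounded_polys_fractions_subfield] insert.prems by blast
  then obtain r s E where b: "b = r / s" "s \<noteq> 0" "r \<in> bounded_polys K I x E" "s \<in> bounded_polys K I x E"
    by blast
  have "q * s * b' \<in> bounded_polys K I x (D + E)" if "b' \<in> insert b B" for b'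
  proof (cases "b' = b")
    case True
    then show ?thesis using bounded_polys_mult[OF q(2) b(3)] b by simp
  next
    case False
    then show ?thesis using bounded_polys_mult[OF _ b(4), of "q * b'" D] q that by (simp add: mult_ac)
  qed
  moreover have "q * s \<in> bounded_polys K I x (D + E)"
    using q b by (intro bounded_polys_mult)
  moreover have "q * s \<noteq> 0"
    using q b by simp
  ultimately show ?case by blast
qed

end

text \<open>Enlarging the supports adds only zero coefficients and factors \<open>x i ^ 0\<close>.
  With fixed index sets, all monomials become products over the same \<open>B\<close>.\<close>

lemma mpoly_eval_eq_sum:
  assumes "finite J" "Poly_Mapping.keys p \<subseteq> J" "finite B" "\<And>m. m \<in> J \<Longrightarrow> Poly_Mapping.keys m \<subseteq> B"
  shows "mpoly_eval x p = (\<Sum>m\<in>J. Poly_Mapping.lookup p m * (\<Prod>i\<in>B. x i ^ Poly_Mapping.lookup m i))"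
proof -
  have "mpoly_eval x p =
      (\<Sum>m\<in>J. Poly_Mapping.lookup p m * (\<Prod>i\<in>Poly_Mapping.keys m. x i ^ Poly_Mapping.lookup m i))"
    unfolding mpoly_eval_def using assms(1,2)
    by (intro sum.mono_neutral_left) (auto simp: in_keys_iff)
  also have "\<dots> = (\<Sum>m\<in>J. Poly_Mapping.lookup p m * (\<Prod>i\<in>B. x i ^ Poly_Mapping.lookup m i))"
    using assms(3,4)
    by (intro sum.cong refl arg_cong2[of _ _ _ _ "(*)"] prod.mono_neutral_left) (auto simp: in_keys_iff)
  finally show ?thesis .
qed

text \<open>Restriction to \<open>B\<close> is a bijection onto
  \<open>B \<rightarrow>\<^sub>E {..N}\<close>, with extension by zero as its inverse.\<close>

lemma bounded_exponents:
  fixes N :: nat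
  assumes "finite B"
  defines "J \<equiv> {m :: 'i \<Rightarrow>\<^sub>0 nat. Poly_Mapping.keys m \<subseteq> B \<and> (\<forall>b. Poly_Mapping.lookup m b \<le> N)}"
  shows "finite J" "card J = (N + 1) ^ card B"
proof -
  have "bij_betw (\<lambda>m. restrict (Poly_Mapping.lookup m) B) J (B \<rightarrow>\<^sub>E {..N})"
  proof (rule bij_betw_byWitness[where f' = "\<lambda>f. Abs_poly_mapping (\<lambda>b. if b \<in> B then f b else 0)"])
    have lookup: "Poly_Mapping.lookup (Abs_poly_mapping (\<lambda>b. if b \<in> B then f b else 0)) =
        (\<lambda>b. if b \<in> B then f b else (0::nat))" for f
    proof -
      have "finite {b. (if b \<in> B then f b else 0) \<noteq> (0::nat)}"
        by (rule finite_subset[OF _ assms(1)]) auto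
      then show ?thesis by (simp add: Abs_poly_mapping_inverse)
    qed
    show "\<forall>m\<in>J. Abs_poly_mapping (\<lambda>b. if b \<in> B then restrict (Poly_Mapping.lookup m) B b else 0) = m"
      by (auto intro!: poly_mapping_eqI simp only: lookup) (auto simp: J_def in_keys_iff)
    show "\<forall>f\<in>B \<rightarrow>\<^sub>E {..N}. restrict (Poly_Mapping.lookup (Abs_poly_mapping (\<lambda>b. if b \<in> B then f b else 0))) B = f"
      by (auto simp: lookup fun_eq_iff restrict_def PiE_def extensional_def)
    show "(\<lambda>m. restrict (Poly_Mapping.lookup m) B) ` J \<subseteq> B \<rightarrow>\<^sub>E {..N}"
      by (auto simp: J_def)
    show "(\<lambda>f. Abs_poly_mapping (\<lambda>b. if b \<in> B then f b else 0)) ` (B \<rightarrow>\<^sub>E {..N}) \<subseteq> J"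
      by (auto simp: J_def lookup in_keys_iff split: if_splits)
  qed
  moreover have "finite (B \<rightarrow>\<^sub>E {..N})" "card (B \<rightarrow>\<^sub>E {..N}) = (N + 1) ^ card B"
    using assms(1) by (auto intro!: finite_PiE simp: card_PiE)
  ultimately show "finite J" "card J = (N + 1) ^ card B"
    by (auto simp: bij_betw_finite bij_betw_same_card)
qed

text \<open>
  Dimension count: there are \<open>(N + 1) ^ card B\<close> monomials in \<open>B\<close> with exponents at most \<open>N\<close>; after
  clearing denominators they lie in a space of dimension \<open>O(N ^ card I)\<close>.
\<close>
lemma algebraically_independent_card_le:
  fixes x :: "'i \<Rightarrow> 'a::field"
  assumes K: "is_subfield K" and I: "finite I" and B: "finite B" "B \<subseteq> field_adjoin K (x ` I)"
    and indep: "algebraically_independent K B (\<lambda>b. b)"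
  shows "card B \<le> card I"
proof (rule ccontr)
  assume less: "\<not> card B \<le> card I"
  obtain q D where q: "q \<noteq> 0" "q \<in> bounded_polys K I x D" "\<And>b. b \<in> B \<Longrightarrow> q * b \<in> bounded_polys K I x D"
    using field_adjoin_common_denominator[OF K I B] by blast
  define M where "M = card B * D"
  \<comment> \<open>Chosen so that
    \<open>((M + 1) * (N + 1)) ^ card I = N * (N + 1) ^ card I\<close>. The left side bounds the
    dimension \<open>card S\<close>; the right side is below \<open>(N + 1) ^ Suc (card I)\<close>,
    hence below the number of exponent vectors.\<close>
  define N where "N = (M + 1) ^ card I"
  define J where "J = {m :: 'a \<Rightarrow>\<^sub>0 nat. Poly_Mapping.keys m \<subseteq> B \<and> (\<forall>b. Poly_Mapping.lookup m b \<le> N)}"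
  define S where "S = bounded_monomials I x (card B * (N * D))"
  define y where "y m = (\<Prod>b\<in>B. b ^ Poly_Mapping.lookup m b)" for m
  have J: "finite J" "card J = (N + 1) ^ card B"
    unfolding J_def by (rule bounded_exponents[OF B(1)])+
  have S: "finite S"
    unfolding S_def by (rule finite_bounded_monomials[OF I])
  have "card S \<le> (N * M + 1) ^ card I"
    using card_bounded_monomials[OF I, of x "card B * (N * D)"] by (simp add: S_def M_def mult_ac)
  also have "\<dots> \<le> ((M + 1) * (N + 1)) ^ card I"
    by (intro power_mono) (auto simp: algebra_simps)
  also have "\<dots> = N * (N + 1) ^ card I"
    by (simp only: power_mult_distrib N_def)
  also have "\<dots> < (N + 1) ^ Suc (card I)"
    by simp
  also have "\<dots> \<le> (N + 1) ^ card B"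
    using less by (intro power_increasing) auto
  finally have card: "card S < card J"
    using J by simp
  \<comment> \<open>Each \<open>b \<in> B\<close> receives a factor \<open>q ^ N\<close>: as many
    copies of \<open>q\<close> as the exponent of \<open>b\<close> clear its denominators, and the
    rest pad the degree bound to \<open>N * D\<close> whatever the exponent is.\<close>
  have "q ^ (card B * N) * y m \<in> subfield_span K S" if "m \<in> J" for m
  proof -
    have le: "Poly_Mapping.lookup m b \<le> N" for b
      using that by (auto simp: J_def)
    have eq: "q ^ (card B * N) * y m =
        (\<Prod>b\<in>B. q ^ (N - Poly_Mapping.lookup m b) * (q * b) ^ Poly_Mapping.lookup m b)"
    proof -
      have "q ^ (N - Poly_Mapping.lookup m b) * (q * b) ^ Poly_Mapping.lookup m b =
          q ^ N * b ^ Poly_Mapping.lookup m b" for b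
        using le[of b] by (simp add: power_mult_distrib mult.assoc[symmetric] power_add[symmetric])
      then show ?thesis
        by (simp add: y_def prod.distrib power_mult[symmetric] mult.commute)
    qed
    have "q ^ (N - Poly_Mapping.lookup m b) * (q * b) ^ Poly_Mapping.lookup m b
        \<in> bounded_polys K I x (N * D)" if "b \<in> B" for b
    proof -
      have "(N - Poly_Mapping.lookup m b) * D + Poly_Mapping.lookup m b * D = N * D"
        using le[of b] by (simp add: add_mult_distrib[symmetric])
      then show ?thesis
        using bounded_polys_mult[OF K I bounded_polys_power[OF K I q(2)] bounded_polys_power[OF K I q(3)[OF that]],
            of "N - Poly_Mapping.lookup m b" "Poly_Mapping.lookup m b"] by simp
    qed
    then show ?thesis
      using bounded_polys_prod[OF K I, of B] by (simp add: eq S_def bounded_polys_def)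
  qed
  then have "\<forall>m\<in>J. \<exists>c. (\<forall>s. c s \<in> K) \<and> q ^ (card B * N) * y m = (\<Sum>s\<in>S. c s * s)"
    by (auto simp: subfield_span_def)
  then obtain c where c: "\<And>m s. m \<in> J \<Longrightarrow> c m s \<in> K"
    "\<And>m. m \<in> J \<Longrightarrow> q ^ (card B * N) * y m = (\<Sum>s\<in>S. c m s * s)"
    by metis
  \<comment> \<open>There are more monomials than spanning elements, so the monomials are linearly
    dependent over \<open>K\<close>.\<close>
  obtain a where a: "\<forall>m\<in>J. a m \<in> K" "\<exists>m\<in>J. a m \<noteq> 0" "\<forall>s\<in>S. (\<Sum>m\<in>J. a m * c m s) = 0"
    using homogeneous_system_nontrivial_solution[OF K S J(1) card, of c] c(1) by blast
  have "q ^ (card B * N) * (\<Sum>m\<in>J. a m * y m) = (\<Sum>m\<in>J. a m * (q ^ (card B * N) * y m))"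
    by (simp add: sum_distrib_left mult_ac)
  also have "\<dots> = (\<Sum>m\<in>J. \<Sum>s\<in>S. a m * c m s * s)"
    using c(2) by (intro sum.cong) (auto simp: sum_distrib_left mult_ac)
  also have "\<dots> = (\<Sum>s\<in>S. (\<Sum>m\<in>J. a m * c m s) * s)"
    by (subst sum.swap) (simp add: sum_distrib_right)
  also have "\<dots> = 0"
    using a(3) by simp
  finally have sum0: "(\<Sum>m\<in>J. a m * y m) = 0"
    using q(1) by simp
  \<comment> \<open>The dependence read as a polynomial. \<open>a\<close> is controlled only on
    \<open>J\<close>, so the other coefficients are set to zero.\<close>
  define p where "p = Abs_poly_mapping (\<lambda>m. if m \<in> J then a m else 0)"
  have "finite {m. (if m \<in> J then a m else 0) \<noteq> 0}"
    by (rule finite_subset[OF _ J(1)]) auto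
  then have p: "Poly_Mapping.lookup p = (\<lambda>m. if m \<in> J then a m else 0)"
    by (simp add: p_def Abs_poly_mapping_inverse)
  then have keys: "Poly_Mapping.keys p \<subseteq> J"
    by (auto simp: in_keys_iff split: if_splits)
  have "mpoly_eval (\<lambda>b. b) p = (\<Sum>m\<in>J. Poly_Mapping.lookup p m * y m)"
    unfolding y_def by (rule mpoly_eval_eq_sum[OF J(1) keys B(1)]) (simp add: J_def)
  also have "\<dots> = 0"
    using sum0 by (simp add: p)
  finally have "mpoly_eval (\<lambda>b. b) p = 0" .
  moreover have "\<forall>m. Poly_Mapping.lookup p m \<in> K"
    using a(1) by (simp add: p subfield_0[OF K])
  moreover have "\<forall>m\<in>Poly_Mapping.keys p. Poly_Mapping.keys m \<subseteq> B"
    using keys by (auto simp: J_def)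
  ultimately have "p = 0"
    using indep unfolding algebraically_independent_def by blast
  then show False
    using a(2) p by (metis lookup_zero)
qed

lemma algebraically_independent_cong:
  assumes "\<And>i. i \<in> I \<Longrightarrow> x i = y i" and "algebraically_independent K I x"
  shows "algebraically_independent K I y"
  unfolding algebraically_independent_def
proof (intro allI impI)
  fix p
  assume p: "(\<forall>m. Poly_Mapping.lookup p m \<in> K) \<and>
    (\<forall>m\<in>Poly_Mapping.keys p. Poly_Mapping.keys m \<subseteq> I) \<and> mpoly_eval y p = 0"
  then have "mpoly_eval x p = mpoly_eval y p"
    unfolding mpoly_eval_def using assms(1)
    by (intro sum.cong refl arg_cong2[of _ _ _ _ "(*)"] prod.cong) (auto simp: subset_iff)
  with p show "p = 0"
    using assms(2) unfolding algebraically_independent_def by simp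
qed

lemma algebraically_independent_subset:
  "algebraically_independent K I x \<Longrightarrow> K' \<subseteq> K \<Longrightarrow> algebraically_independent K' I x"
  unfolding algebraically_independent_def by blast

subsection \<open>Meromorphic functions on the plane\<close>

text \<open>Laurent expansion at 0 respects the field operations. Together with
  \<open>rational_fls_subset_meromorphic_fls\<close> this identifies the base field of the theorem
  with \<open>meromorphic_fls\<close>.\<close>

lemma is_subfield_meromorphic_fls: "is_subfield meromorphic_fls"
  unfolding is_subfield_def
proof (intro conjI ballI)
  show "0 \<in> meromorphic_fls"
    unfolding meromorphic_fls_def by (auto intro!: exI[of _ "\<lambda>_. 0"])
  show "1 \<in> meromorphic_fls"
    unfolding meromorphic_fls_def by (auto intro!: exI[of _ "\<lambda>_. 1"])
  fix X assume "X \<in> meromorphic_fls"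
  then obtain f where f: "f meromorphic_on UNIV" "f has_laurent_expansion X"
    by (auto simp: meromorphic_fls_def)
  show "- X \<in> meromorphic_fls"
    unfolding meromorphic_fls_def using f
    by (auto intro!: exI[of _ "\<lambda>z. - f z"] meromorphic_intros laurent_expansion_intros)
  show "inverse X \<in> meromorphic_fls"
    unfolding meromorphic_fls_def using f
    by (auto intro!: exI[of _ "\<lambda>z. inverse (f z)"] meromorphic_intros laurent_expansion_intros)
  fix Y assume "Y \<in> meromorphic_fls"
  then obtain g where g: "g meromorphic_on UNIV" "g has_laurent_expansion Y"
    by (auto simp: meromorphic_fls_def)
  show "X + Y \<in> meromorphic_fls"
    unfolding meromorphic_fls_def using f g
    by (auto intro!: exI[of _ "\<lambda>z. f z + g z"] meromorphic_intros laurent_expansion_intros)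
  show "X * Y \<in> meromorphic_fls"
    unfolding meromorphic_fls_def using f g
    by (auto intro!: exI[of _ "\<lambda>z. f z * g z"] meromorphic_intros laurent_expansion_intros)
qed

lemma rational_fls_subset_meromorphic_fls: "rational_fls \<subseteq> meromorphic_fls"
proof -
  have poly: "poly p meromorphic_on UNIV" "poly p has_laurent_expansion fps_to_fls (fps_of_poly p)"
    for p :: "complex poly"
  proof -
    have "eval_fps (fps_of_poly p) = poly p"
      by (simp add: fun_eq_iff)
    then show "poly p has_laurent_expansion fps_to_fls (fps_of_poly p)"
      using has_laurent_expansion_fps[OF eval_fps_has_fps_expansion[of "fps_of_poly p"]] by simp
    show "poly p meromorphic_on UNIV"
      by (intro analytic_on_imp_meromorphic_on) (auto simp: analytic_on_open intro!: holomorphic_intros)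
  qed
  show ?thesis
  proof
    fix X assume "X \<in> rational_fls"
    then obtain p q where X: "X = fps_to_fls (fps_of_poly p) / fps_to_fls (fps_of_poly q)"
      by (auto simp: rational_fls_def)
    show "X \<in> meromorphic_fls"
      unfolding meromorphic_fls_def X
      by (auto intro!: exI[of _ "\<lambda>z. poly p z / poly q z"] meromorphic_on_divide has_laurent_expansion_divide poly)
  qed
qed

text \<open>The identity theorem is applied to \<open>remove_sings f\<close>, which agrees with
  \<open>f\<close> on a punctured neighbourhood of every point of \<open>A\<close>. Punctured
  neighbourhoods are the right formulation because a meromorphic \<open>f\<close> may take arbitrary
  values at isolated points.\<close>

lemma meromorphic_identity_theorem:
  assumes f: "f meromorphic_on A" and A: "open A" "connected A" "z \<in> A" "w \<in> A"
    and "eventually (\<lambda>u. f u = 0) (at z)"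
  shows "eventually (\<lambda>u. f u = 0) (at w)"
proof -
  have eq: "eventually (\<lambda>u. remove_sings f u = f u) (at v)" if "v \<in> A" for v
    using that f by (intro eventually_remove_sings_eq_at meromorphic_on_isolated_singularity)
      (auto intro: meromorphic_on_subset)
  have "eventually (\<lambda>u. remove_sings f u = 0) (at z)"
    using assms(6) eq[OF A(3)] by eventually_elim simp
  then have "frequently (\<lambda>u. remove_sings f u = 0) (at z)"
    by (intro eventually_frequently) auto
  then have 0: "remove_sings f v = 0" if "v \<in> A" for v
    using frequently_eq_meromorphic_imp_constant[of "remove_sings f" 0 z A] that A f
    by (auto intro: remove_sings_nicely_meromorphic)
  have "eventually (\<lambda>u. u \<in> A) (at w)"
    using A by (intro eventually_at_in_open') auto
  then show ?thesis
    using eq[OF A(4)] by eventually_elim (use 0 in auto)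
qed

subsection \<open>Asymptotic eigenvectors\<close>

text \<open>
  Subtracting \<open>u p (\<phi> x) / u p x\<close> times the relation at \<open>x\<close> from the relation at \<open>\<phi> x\<close> removes the
  term \<open>p\<close> and leaves the limits of the other ratios unchanged.
\<close>
lemma sum_nonzero_of_distinct_ratio_limits:
  fixes u :: "'m \<Rightarrow> 'x \<Rightarrow> 'a::real_normed_field"
  assumes "G \<noteq> bot" and phi: "filterlim \<phi> G G"
    and "finite S" "S \<noteq> {}"
  shows "inj_on \<mu> S \<Longrightarrow> (\<And>m. m \<in> S \<Longrightarrow> eventually (\<lambda>x. u m x \<noteq> 0) G) \<Longrightarrow>
    (\<And>m. m \<in> S \<Longrightarrow> ((\<lambda>x. u m (\<phi> x) / u m x) \<longlongrightarrow> \<mu> m) G) \<Longrightarrow>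
    \<not> eventually (\<lambda>x. (\<Sum>m\<in>S. u m x) = 0) G"
  using assms(3,4)
proof (induction S arbitrary: u rule: finite_ne_induct)
  case (singleton p)
  show ?case
  proof
    assume "eventually (\<lambda>x. (\<Sum>m\<in>{p}. u m x) = 0) G"
    moreover have "eventually (\<lambda>x. u p x \<noteq> 0) G"
      using singleton by auto
    ultimately have "eventually (\<lambda>x. False) G"
      by eventually_elim auto
    then show False using \<open>G \<noteq> bot\<close> by auto
  qed
next
  case (insert p S)
  define r where "r m x = u m (\<phi> x) / u m x" for m x
  \<comment> \<open>Where \<open>u m x\<close> is nonzero this equals
    \<open>u m (\<phi> x) - r p x * u m x\<close>, so it vanishes for \<open>m = p\<close>. The
    factored form displays the ratio of \<open>v m\<close> under \<open>\<phi>\<close>.\<close>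
  define v where "v m x = u m x * (r m x - r p x)" for m x
  have r: "(r m \<longlongrightarrow> \<mu> m) G" if "m \<in> insert p S" for m
    using insert.prems(3)[OF that] by (simp add: r_def[abs_def])
  have rphi: "((\<lambda>x. r m (\<phi> x)) \<longlongrightarrow> \<mu> m) G" if "m \<in> insert p S" for m
    by (rule filterlim_compose[OF r[OF that] phi])
  have ne: "\<mu> m - \<mu> p \<noteq> 0" if "m \<in> S" for m
    using insert.prems(1) insert.hyps that by (auto simp: inj_on_def)
  have d: "((\<lambda>x. r m x - r p x) \<longlongrightarrow> \<mu> m - \<mu> p) G" if "m \<in> S" for m
    using that by (intro tendsto_diff r) auto
  have dphi: "((\<lambda>x. r m (\<phi> x) - r p (\<phi> x)) \<longlongrightarrow> \<mu> m - \<mu> p) G" if "m \<in> S" for m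
    using that by (intro tendsto_diff rphi) auto
  show ?case
  proof
    assume sum0: "eventually (\<lambda>x. (\<Sum>m\<in>insert p S. u m x) = 0) G"
    have sum0': "eventually (\<lambda>x. (\<Sum>m\<in>insert p S. u m (\<phi> x)) = 0) G"
      by (rule eventually_compose_filterlim[OF sum0 phi])
    have nz: "eventually (\<lambda>x. \<forall>m\<in>insert p S. u m x \<noteq> 0) G"
      using insert.prems(2) insert.hyps(1) by (intro eventually_ball_finite) auto
    have "eventually (\<lambda>x. (\<Sum>m\<in>S. v m x) = 0) G"
      using sum0 sum0' nz
    proof eventually_elim
      case (elim x)
      have "(\<Sum>m\<in>S. v m x) = (\<Sum>m\<in>insert p S. v m x)"
        using insert.hyps by (simp add: v_def)
      also have "\<dots> = (\<Sum>m\<in>insert p S. u m (\<phi> x) - r p x * u m x)"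
        by (rule sum.cong[OF refl]) (use elim(3) in \<open>auto simp: v_def r_def field_simps\<close>)
      also have "\<dots> = (\<Sum>m\<in>insert p S. u m (\<phi> x)) - r p x * (\<Sum>m\<in>insert p S. u m x)"
        by (simp only: sum_subtractf sum_distrib_left)
      finally show ?case using elim by simp
    qed
    moreover have "\<not> eventually (\<lambda>x. (\<Sum>m\<in>S. v m x) = 0) G"
    proof (rule insert.IH)
      show "inj_on \<mu> S" using insert.prems(1) by (auto simp: inj_on_def)
      fix m assume m: "m \<in> S"
      have d0: "eventually (\<lambda>x. r m x - r p x \<noteq> 0) G"
        using tendsto_imp_eventually_ne[OF d[OF m] ne[OF m]] .
      have "eventually (\<lambda>x. u m x \<noteq> 0) G" using insert.prems(2) m by auto
      then show "eventually (\<lambda>x. v m x \<noteq> 0) G"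
        using d0 by eventually_elim (simp add: v_def)
      \<comment> \<open>Both differences tend to the nonzero number
        \<open>\<mu> m - \<mu> p\<close>, so their quotient tends to 1 and \<open>v m\<close>
        inherits the ratio limit of \<open>u m\<close>.\<close>
      have "((\<lambda>x. r m x * ((r m (\<phi> x) - r p (\<phi> x)) / (r m x - r p x))) \<longlongrightarrow>
          \<mu> m * ((\<mu> m - \<mu> p) / (\<mu> m - \<mu> p))) G"
        using m ne[OF m] by (intro tendsto_mult tendsto_divide r d dphi) auto
      then show "((\<lambda>x. v m (\<phi> x) / v m x) \<longlongrightarrow> \<mu> m) G"
        using ne[OF m] by (simp add: v_def r_def mult_ac)
    qed
    ultimately show False by simp
  qed
qed

section \<open>Limits of ratios under \<open>x \<mapsto> x ^ k\<close> at 1\<close>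

lemma filterlim_power_at_left_1:
  assumes "k \<ge> 1"
  shows "filterlim (\<lambda>x::real. x ^ k) (at_left 1) (at_left 1)"
proof (rule filterlim_at_withinI)
  show "((\<lambda>x::real. x ^ k) \<longlongrightarrow> 1) (at_left 1)"
    by (rule tendsto_eq_intros refl)+ auto
  have "eventually (\<lambda>x::real. x \<in> {0<..<1}) (at_left 1)"
    by (rule eventually_at_leftI[of 0]) auto
  then show "eventually (\<lambda>x::real. x ^ k \<in> {..<1} - {1}) (at_left 1)"
    by eventually_elim (use assms in \<open>auto simp: power_less_one_iff\<close>)
qed

text \<open>The quotient is a geometric sum of \<open>k\<close> terms, each tending to 1.\<close>

lemma tendsto_one_minus_power_ratio:
  "((\<lambda>x::real. (1 - x ^ k) / (1 - x)) \<longlongrightarrow> real k) (at_left 1)"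
proof -
  have "((\<lambda>x::real. \<Sum>i<k. x ^ i) \<longlongrightarrow> (\<Sum>i<k. 1 ^ i)) (at_left 1)"
    by (intro tendsto_intros)
  moreover have "eventually (\<lambda>x::real. (\<Sum>i<k. x ^ i) = (1 - x ^ k) / (1 - x)) (at_left 1)"
    by (rule eventually_at_leftI[of 0]) (auto simp: sum_gp_strict)
  ultimately show ?thesis
    by (simp add: filterlim_cong[OF refl refl])
qed

text \<open>The oscillating factor cancels by \<open>C x = C (x ^ k)\<close>, its lower bound
  keeping it nonzero. What remains is the power of \<open>(1 - x ^ k) / (1 - x)\<close> with
  exponent minus the base-\<open>k\<close> logarithm of \<open>l\<close>, and that quotient tends to
  \<open>k\<close>.\<close>

lemma eigenvalue_ratio:
  assumes k: "k \<ge> 2" and "is_mahler_eigenvalue k F l"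
  shows "eventually (\<lambda>x. eval_fps F (of_real x) \<noteq> 0) (at_left 1)"
    and "((\<lambda>x. eval_fps F (of_real (x ^ k)) / eval_fps F (of_real x)) \<longlongrightarrow> inverse l) (at_left 1)"
proof -
  define s where "s = - (Ln l / of_real (ln (real k)))"
  obtain C b B where l: "l \<noteq> 0" and C: "0 < b" "\<And>x. x \<in> {0<..<1} \<Longrightarrow> b \<le> norm (C x)"
    "\<And>x. x \<in> {0<..<1} \<Longrightarrow> C x = C (x ^ k)"
    and equiv: "(\<lambda>x. eval_fps F (of_real x)) \<sim>[at_left 1] (\<lambda>x. C x * of_real (1 - x) powr s)"
    using assms(2) unfolding is_mahler_eigenvalue_def s_def by blast
  define g where "g x = C x * of_real (1 - x) powr s" for x
  have ev: "eventually (\<lambda>x::real. x \<in> {0<..<1}) (at_left 1)"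
    by (rule eventually_at_leftI[of 0]) auto
  have gnz: "eventually (\<lambda>x. g x \<noteq> 0) (at_left 1)"
    using ev by eventually_elim (use C in \<open>force simp: g_def\<close>)
  have equiv': "(\<lambda>x. eval_fps F (of_real x)) \<sim>[at_left 1] g"
    using equiv by (simp add: g_def[abs_def])
  show "eventually (\<lambda>x. eval_fps F (of_real x) \<noteq> 0) (at_left 1)"
    using asymp_equiv_eventually_zeros[OF equiv'] gnz by eventually_elim auto
  have "(\<lambda>x. eval_fps F (of_real (x ^ k)) / eval_fps F (of_real x)) \<sim>[at_left 1] (\<lambda>x. g (x ^ k) / g x)"
    using asymp_equiv_compose'[OF equiv' filterlim_power_at_left_1[of k]] equiv' k
    by (intro asymp_equiv_divide) auto
  moreover have "((\<lambda>x. g (x ^ k) / g x) \<longlongrightarrow> inverse l) (at_left 1)"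
  proof -
    have "((\<lambda>x. exp (s * of_real (ln ((1 - x ^ k) / (1 - x))))) \<longlongrightarrow> exp (s * of_real (ln (real k)))) (at_left 1)"
      using k by (intro tendsto_intros tendsto_one_minus_power_ratio) auto
    moreover have "exp (s * of_real (ln (real k))) = inverse l"
      using k l by (simp add: s_def exp_minus)
    moreover have "eventually (\<lambda>x. exp (s * of_real (ln ((1 - x ^ k) / (1 - x)))) = g (x ^ k) / g x) (at_left 1)"
      using ev
    proof eventually_elim
      case (elim x)
      have xk: "x ^ k < 1" using elim k by (simp add: power_less_one_iff)
      \<comment> \<open>On positive reals the principal logarithm is the real one, so quotients of
        powers can be computed without branch corrections.\<close>
      have pw: "of_real y powr s = exp (s * of_real (ln y))" if "y > 0" for y :: real
        using that by (simp add: powr_def Ln_of_real)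
      have "C x \<noteq> 0" using C(1) C(2)[OF elim] by auto
      then have "g (x ^ k) / g x = of_real (1 - x ^ k) powr s / of_real (1 - x) powr s"
        using C(3)[OF elim] by (simp add: g_def)
      also have "\<dots> = exp (s * of_real (ln (1 - x ^ k)) - s * of_real (ln (1 - x)))"
        using elim xk by (simp only: pw exp_diff diff_gt_0_iff_gt greaterThanLessThan_iff)
      also have "\<dots> = exp (s * of_real (ln ((1 - x ^ k) / (1 - x))))"
        using elim xk by (simp add: ln_div algebra_simps)
      finally show ?case by simp
    qed
    ultimately show ?thesis
      by (simp add: filterlim_cong[OF refl refl])
  qed
  ultimately show "((\<lambda>x. eval_fps F (of_real (x ^ k)) / eval_fps F (of_real x)) \<longlongrightarrow> inverse l) (at_left 1)"
    by (simp add: asymp_equiv_tendsto_transfer asymp_equiv_sym)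
qed

lemma filterlim_of_real_at_left: "filterlim (complex_of_real) (at (of_real a)) (at_left a)"
  by (rule filterlim_at_withinI) (auto intro!: tendsto_intros simp: eventually_at_filter)

text \<open>Near 1 the function behaves like its leading Laurent term, a constant times
  \<open>(z - 1) powi n\<close>. The constant cancels in the ratio, leaving the \<open>n\<close>-th
  power of a quotient that tends to \<open>k\<close>; a zero or a pole at 1 is covered by the sign
  of \<open>n\<close>.\<close>

lemma meromorphic_ratio:
  assumes k: "k \<ge> 1" and f: "f meromorphic_on {1}" and nz: "\<not> eventually (\<lambda>z. f z = 0) (at 1)"
  shows "eventually (\<lambda>x. f (of_real x) \<noteq> 0) (at_left 1)"
    and "\<exists>n. ((\<lambda>x. f (of_real (x ^ k)) / f (of_real x)) \<longlongrightarrow> of_nat k powi n) (at_left 1)"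
proof -
  define L where "L = laurent_expansion f 1"
  have L: "(\<lambda>w. f (1 + w)) has_laurent_expansion L"
    unfolding L_def by (rule meromorphic_on_imp_has_laurent_expansion[OF f]) auto
  have "L \<noteq> 0"
    using nz has_laurent_expansion_eventually_zero_iff[OF L] by simp
  define n where "n = fls_subdegree L"
  define c where "c = fls_nth L n"
  have c: "c \<noteq> 0" using \<open>L \<noteq> 0\<close> by (simp add: c_def n_def)
  have "f \<sim>[at 1] (\<lambda>w. c * (w - 1) powi n)"
    unfolding c_def n_def by (rule has_laurent_expansion_imp_asymp_equiv[OF L])
  define g :: "real \<Rightarrow> complex" where "g x = c * (of_real x - 1) powi n" for x
  have equiv: "(\<lambda>x. f (of_real x)) \<sim>[at_left 1] g"
    unfolding g_def
    by (rule asymp_equiv_compose'[OF \<open>f \<sim>[at 1] _\<close>]) (use filterlim_of_real_at_left[of 1] in simp)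
  have ev: "eventually (\<lambda>x::real. x \<in> {0<..<1}) (at_left 1)"
    by (rule eventually_at_leftI[of 0]) auto
  have gnz: "eventually (\<lambda>x. g x \<noteq> 0) (at_left 1)"
    using ev by eventually_elim (use c in \<open>auto simp: g_def\<close>)
  show "eventually (\<lambda>x. f (of_real x) \<noteq> 0) (at_left 1)"
    using asymp_equiv_eventually_zeros[OF equiv] gnz by eventually_elim auto
  have "(\<lambda>x. f (of_real (x ^ k)) / f (of_real x)) \<sim>[at_left 1] (\<lambda>x. g (x ^ k) / g x)"
    using asymp_equiv_compose'[OF equiv filterlim_power_at_left_1[of k]] equiv k
    by (intro asymp_equiv_divide) auto
  moreover have "((\<lambda>x. g (x ^ k) / g x) \<longlongrightarrow> of_nat k powi n) (at_left 1)"
  proof -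
    have "((\<lambda>x::real. complex_of_real ((1 - x ^ k) / (1 - x)) powi n) \<longlongrightarrow> of_real (real k) powi n) (at_left 1)"
      using k by (intro tendsto_power_int tendsto_of_real tendsto_one_minus_power_ratio) auto
    moreover have "eventually (\<lambda>x::real. complex_of_real ((1 - x ^ k) / (1 - x)) powi n = g (x ^ k) / g x) (at_left 1)"
      using ev
    proof eventually_elim
      case (elim x)
      have "g (x ^ k) / g x = ((of_real (x ^ k) - 1) / (of_real x - 1)) powi n"
        using c by (simp add: g_def power_int_divide_distrib)
      also have "(of_real (x ^ k) - 1) / (of_real x - 1) = (of_real ((1 - x ^ k) / (1 - x)) :: complex)"
      proof -
        have "(1 - x ^ k) / (1 - x) = (x ^ k - 1) / (x - 1)"
          using elim by (simp add: field_simps)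
        then show ?thesis by simp
      qed
      finally show ?case by simp
    qed
    ultimately show ?thesis
      by (simp add: filterlim_cong[OF refl refl])
  qed
  ultimately have "((\<lambda>x. f (of_real (x ^ k)) / f (of_real x)) \<longlongrightarrow> of_nat k powi n) (at_left 1)"
    by (simp add: asymp_equiv_tendsto_transfer asymp_equiv_sym)
  then show "\<exists>n. ((\<lambda>x. f (of_real (x ^ k)) / f (of_real x)) \<longlongrightarrow> of_nat k powi n) (at_left 1)" ..
qed

subsection \<open>Algebraic independence\<close>

text \<open>The index type is arbitrary so that the result applies both to the family on
  \<open>{1..d}\<close> and to the set of its values, indexed by itself.\<close>

lemma algebraically_independent_of_mahler_eigenvalues:
  fixes F :: "'i \<Rightarrow> complex fps"
  assumes k: "k \<ge> 2" and I: "finite I"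
    and conv: "\<And>i. i \<in> I \<Longrightarrow> fps_conv_radius (F i) \<ge> 1"
    and eig: "\<And>i. i \<in> I \<Longrightarrow> is_mahler_eigenvalue k (F i) (l i)"
    and indep: "\<And>(n::int) e. of_nat k powi n * (\<Prod>i\<in>I. l i powi e i) = 1 \<Longrightarrow> \<forall>i\<in>I. e i = 0"
  shows "algebraically_independent meromorphic_fls I (\<lambda>i. fps_to_fls (F i))"
  unfolding algebraically_independent_def
proof (intro allI impI, elim conjE, rule ccontr)
  fix p :: "('i \<Rightarrow>\<^sub>0 nat) \<Rightarrow>\<^sub>0 complex fls"
  assume coeffs: "\<forall>m. Poly_Mapping.lookup p m \<in> meromorphic_fls"
    and keys: "\<forall>m\<in>Poly_Mapping.keys p. Poly_Mapping.keys m \<subseteq> I"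
    and eval: "mpoly_eval (\<lambda>i. fps_to_fls (F i)) p = 0" and "p \<noteq> 0"
  define S where "S = Poly_Mapping.keys p"
  have S: "finite S" "S \<noteq> {}"
    using \<open>p \<noteq> 0\<close> by (auto simp: S_def)
  obtain f where f: "\<And>m. f m meromorphic_on UNIV" "\<And>m. f m has_laurent_expansion Poly_Mapping.lookup p m"
    using coeffs unfolding meromorphic_fls_def mem_Collect_eq by metis
  define T where "T m z = f m z * (\<Prod>i\<in>I. eval_fps (F i) z ^ Poly_Mapping.lookup m i)" for m z
  have radius: "ereal (norm z) < fps_conv_radius (F i)" if "i \<in> I" "z \<in> ball 0 1" for i and z :: complex
    using conv[OF that(1)] that(2) by (auto intro: less_le_trans[of _ 1])
  have "(\<lambda>z. \<Sum>m\<in>S. T m z) has_laurent_expansion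
      (\<Sum>m\<in>S. Poly_Mapping.lookup p m * (\<Prod>i\<in>I. fps_to_fls (F i) ^ Poly_Mapping.lookup m i))"
    unfolding T_def
    by (intro laurent_expansion_intros f(2) has_laurent_expansion_fps eval_fps_has_fps_expansion
        less_le_trans[OF _ conv]) auto
  also have "(\<Sum>m\<in>S. Poly_Mapping.lookup p m * (\<Prod>i\<in>I. fps_to_fls (F i) ^ Poly_Mapping.lookup m i)) = 0"
    using mpoly_eval_eq_sum[OF S(1) _ I, of p "\<lambda>i. fps_to_fls (F i)"] keys eval by (simp add: S_def)
  finally have "eventually (\<lambda>z. (\<Sum>m\<in>S. T m z) = 0) (at 0)"
    using has_laurent_expansion_eventually_zero_iff[of "\<lambda>z. \<Sum>m\<in>S. T m z" 0 0] by simp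
  moreover have "(\<lambda>z. \<Sum>m\<in>S. T m z) meromorphic_on ball 0 1"
  proof -
    have "f m meromorphic_on ball 0 1" for m
      by (rule meromorphic_on_subset[OF f(1)]) auto
    moreover have "eval_fps (F i) meromorphic_on ball 0 1" if "i \<in> I" for i
      by (rule meromorphic_on_eval_fps[OF analytic_on_ident]) (rule radius[OF that])
    ultimately show ?thesis
      unfolding T_def
      by (intro meromorphic_on_sum meromorphic_on_mult meromorphic_on_prod meromorphic_on_power)
  qed
  \<comment> \<open>The formal relation gives vanishing only near 0; the identity theorem carries it
    through the unit disc, where all terms are meromorphic.\<close>
  ultimately have zero_near: "eventually (\<lambda>z. (\<Sum>m\<in>S. T m z) = 0) (at w)" if "w \<in> ball 0 1" for w
    using meromorphic_identity_theorem[of "\<lambda>z. \<Sum>m\<in>S. T m z" "ball 0 1" 0 w] that by simp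
  have ev: "eventually (\<lambda>x::real. x \<in> {0<..<1}) (at_left 1)"
    by (rule eventually_at_leftI[of 0]) auto
  \<comment> \<open>The points where \<open>f m\<close> fails to be analytic do not accumulate at 1.
    Near 1 the terms are therefore continuous at real points, which turns vanishing on punctured
    neighbourhoods into vanishing at the points themselves.\<close>
  have "eventually (\<lambda>x. f m analytic_on {of_real x}) (at_left 1)" for m
  proof -
    have "eventually (\<lambda>z. f m analytic_on {z}) (at 1)"
      using meromorphic_on_imp_not_islimpt_singularities[OF f(1), of 1 m]
      by (simp add: islimpt_iff_eventually)
    moreover have "filterlim complex_of_real (at 1) (at_left 1)"
      using filterlim_of_real_at_left[of 1] by simp
    ultimately show ?thesis
      by (rule eventually_compose_filterlim)
  qed
  then have "eventually (\<lambda>x. \<forall>m\<in>S. f m analytic_on {of_real x}) (at_left 1)"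
    using S(1) by (intro eventually_ball_finite) auto
  then have sum0: "eventually (\<lambda>x. (\<Sum>m\<in>S. T m (of_real x)) = 0) (at_left 1)"
    using ev
  proof eventually_elim
    case (elim x)
    have x: "complex_of_real x \<in> ball 0 1"
      using elim by auto
    have "(\<lambda>z. \<Sum>m\<in>S. T m z) analytic_on {of_real x}"
      unfolding T_def using elim(1) radius[OF _ x]
      by (intro analytic_on_sum analytic_on_mult analytic_on_prod analytic_on_power
          analytic_on_eval_fps[OF analytic_on_ident]) auto
    then have "((\<lambda>z. \<Sum>m\<in>S. T m z) \<longlongrightarrow> (\<Sum>m\<in>S. T m (of_real x))) (at (of_real x))"
      by (intro isContD analytic_at_imp_isCont)
    moreover have "((\<lambda>z. \<Sum>m\<in>S. T m z) \<longlongrightarrow> 0) (at (complex_of_real x))"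
      by (rule tendsto_eventually[OF zero_near[OF x]])
    ultimately show ?case
      by (rule tendsto_unique[rotated]) auto
  qed

  \<comment> \<open>A coefficient vanishing near 1 would vanish near 0, since it is meromorphic on
    the whole plane, against its nonzero Laurent series.\<close>
  have f_nz: "\<not> eventually (\<lambda>z. f m z = 0) (at 1)" if "m \<in> S" for m
  proof
    assume "eventually (\<lambda>z. f m z = 0) (at 1)"
    then have "eventually (\<lambda>z. f m z = 0) (at 0)"
      using meromorphic_identity_theorem[OF f(1) open_UNIV connected_UNIV, of 1 0 m] by simp
    then show False
      using has_laurent_expansion_eventually_zero_iff[of "f m" 0] f(2)[of m] that
      by (simp add: S_def in_keys_iff)
  qed
  have f1: "f m meromorphic_on {1}" for m
    by (rule meromorphic_on_subset[OF f(1)]) auto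
  have "\<forall>m\<in>S. \<exists>n. ((\<lambda>x. f m (of_real (x ^ k)) / f m (of_real x)) \<longlongrightarrow> of_nat k powi n) (at_left 1)"
    using meromorphic_ratio(2)[OF _ f1 f_nz] k by simp
  then obtain n where n: "\<And>m. m \<in> S \<Longrightarrow>
      ((\<lambda>x. f m (of_real (x ^ k)) / f m (of_real x)) \<longlongrightarrow> of_nat k powi n m) (at_left 1)"
    by metis
  \<comment> \<open>The limiting ratio of the term \<open>T m\<close>: a power of \<open>k\<close>
    from the coefficient, and an inverse power of each eigenvalue.\<close>
  define \<mu> where "\<mu> m = of_nat k powi n m * (\<Prod>i\<in>I. inverse (l i) ^ Poly_Mapping.lookup m i)" for m

  have "\<not> eventually (\<lambda>x. (\<Sum>m\<in>S. T m (of_real x)) = 0) (at_left 1)"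
  proof (rule sum_nonzero_of_distinct_ratio_limits[where \<phi> = "\<lambda>x. x ^ k" and \<mu> = \<mu>])
    show "at_left (1::real) \<noteq> bot" by simp
    show "filterlim (\<lambda>x::real. x ^ k) (at_left 1) (at_left 1)"
      using k by (intro filterlim_power_at_left_1) auto
    show "finite S" "S \<noteq> {}" by fact+
    show "inj_on \<mu> S"
    proof (rule inj_onI)
      fix m m' assume m: "m \<in> S" "m' \<in> S" "\<mu> m = \<mu> m'"
      define P where "P m = (\<Prod>i\<in>I. l i powi int (Poly_Mapping.lookup m i))" for m
      have l: "l i \<noteq> 0" if "i \<in> I" for i
        using eig[OF that] by (auto simp: is_mahler_eigenvalue_def)
      have P: "P m \<noteq> 0" for m
        using l I by (auto simp: P_def)
      have \<mu>: "\<mu> m = of_nat k powi n m / P m" for m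
        by (simp add: \<mu>_def P_def power_inverse prod_inversef[symmetric] divide_inverse)
      \<comment> \<open>Equal ratios for \<open>m\<close> and \<open>m'\<close> give a
        multiplicative relation among \<open>k\<close> and the eigenvalues whose exponents are the
        differences of the two monomials.\<close>
      have "of_nat k powi (n m - n m') *
          (\<Prod>i\<in>I. l i powi (int (Poly_Mapping.lookup m' i) - int (Poly_Mapping.lookup m i))) =
          (of_nat k powi n m / of_nat k powi n m') * (P m' / P m)"
        unfolding P_def prod_dividef[symmetric] using k l
        by (intro arg_cong2[of _ _ _ _ "(*)"] prod.cong refl power_int_diff) auto
      also have "\<dots> = \<mu> m / \<mu> m'"
        by (simp add: \<mu>)
      also have "\<dots> = 1"
        using k P[of m'] m(3) by (simp add: \<mu>)
      finally have "\<forall>i\<in>I. int (Poly_Mapping.lookup m' i) - int (Poly_Mapping.lookup m i) = 0"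
        by (rule indep)
      moreover have "Poly_Mapping.lookup m i = 0" "Poly_Mapping.lookup m' i = 0" if "i \<notin> I" for i
        using m(1,2) keys that by (auto simp: S_def in_keys_iff subset_iff)
      ultimately show "m = m'"
        by (intro poly_mapping_eqI) (metis eq_iff_diff_eq_0 of_nat_eq_iff)
    qed
  next
    fix m assume m: "m \<in> S"
    have "eventually (\<lambda>x. \<forall>i\<in>I. eval_fps (F i) (of_real x) \<noteq> 0) (at_left 1)"
      using I eigenvalue_ratio(1)[OF k eig] by (intro eventually_ball_finite) auto
    moreover have "eventually (\<lambda>x. f m (of_real x) \<noteq> 0) (at_left 1)"
      by (rule meromorphic_ratio(1)[OF _ f1 f_nz[OF m], of 1]) simp
    ultimately show "eventually (\<lambda>x. T m (of_real x) \<noteq> 0) (at_left 1)"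
      by eventually_elim (use I in \<open>auto simp: T_def\<close>)
    have "((\<lambda>x. f m (of_real (x ^ k)) / f m (of_real x) *
        (\<Prod>i\<in>I. (eval_fps (F i) (of_real (x ^ k)) / eval_fps (F i) (of_real x)) ^ Poly_Mapping.lookup m i))
        \<longlongrightarrow> \<mu> m) (at_left 1)"
      unfolding \<mu>_def by (intro tendsto_intros n m eigenvalue_ratio(2)[OF k eig])
    then show "((\<lambda>x. T m (of_real (x ^ k)) / T m (of_real x)) \<longlongrightarrow> \<mu> m) (at_left 1)"
      by (simp add: T_def power_divide prod_dividef)
  qed
  with sum0 show False by blast
qed

section \<open>The exact transcendence degree\<close>

theorem theorem1:
  fixes k d :: nat and F :: "nat \<Rightarrow> complex fps" and lam :: "nat \<Rightarrow> complex"
  assumes "k \<ge> 2"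
    and "\<And>i. i \<in> {1..d} \<Longrightarrow> is_mahler k (F i)"
    and "\<And>i. i \<in> {1..d} \<Longrightarrow> fps_conv_radius (F i) \<ge> 1"
    and "\<And>i. i \<in> {1..d} \<Longrightarrow> is_mahler_eigenvalue k (F i) (lam i)"
    and "multiplicatively_independent {0..d} (\<lambda>i. if i = 0 then of_nat k else lam i)"
  shows "transcendence_degree
           (field_adjoin rational_fls meromorphic_fls)
           (field_adjoin (field_adjoin rational_fls meromorphic_fls)
              ((\<lambda>i. fps_to_fls (F i)) ` {1..d})) = enat d
         \<and> algebraically_independent rational_fls {1..d} (\<lambda>i. fps_to_fls (F i))"
proof -
  let ?x = "\<lambda>i. fps_to_fls (F i)"
  define B where "B = ?x ` {1..d}"
  have K: "field_adjoin rational_fls meromorphic_fls = meromorphic_fls"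
    using field_adjoin_minimal[OF is_subfield_meromorphic_fls rational_fls_subset_meromorphic_fls order.refl]
      field_adjoin_superset by blast
  have indep: "\<forall>i\<in>{1..d}. e i = 0" if "of_nat k powi n * (\<Prod>i\<in>{1..d}. lam i powi e i) = 1" for n :: int and e
  proof -
    \<comment> \<open>Index 0 carries \<open>k\<close> in the hypothesis, so its exponent
      \<open>n\<close> is put into \<open>e\<close> at 0.\<close>
    have "(\<Prod>i\<in>{1..d}. (if i = 0 then of_nat k else lam i) powi (e(0 := n)) i) =
        (\<Prod>i\<in>{1..d}. lam i powi e i)"
      by (intro prod.cong) auto
    moreover have "{0..d} = insert 0 {1..d}"
      by auto
    ultimately have "(\<Prod>i\<in>{0..d}. (if i = 0 then of_nat k else lam i) powi (e(0 := n)) i) = 1"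
      using that by simp
    then have "\<forall>i\<in>{0..d}. (e(0 := n)) i = 0"
      using assms(5) unfolding multiplicatively_independent_def by blast
    then show ?thesis by force
  qed
  \<comment> \<open>The transcendence degree counts elements of a set, so the functions must be
    distinct. Equal functions would have equal eigenvalues by uniqueness of limits, and exponents 1
    and -1 would then give a forbidden relation.\<close>
  have inj: "inj_on ?x {1..d}"
  proof (rule inj_onI, rule ccontr)
    fix i j assume ij: "i \<in> {1..d}" "j \<in> {1..d}" "?x i = ?x j" "i \<noteq> j"
    then have "F i = F j"
      by simp
    then have "inverse (lam i) = inverse (lam j)"
      using tendsto_unique[OF _ eigenvalue_ratio(2)[OF assms(1) assms(4)[OF ij(1)]]]
        eigenvalue_ratio(2)[OF assms(1) assms(4)[OF ij(2)]] by simp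
    then have eq: "lam i = lam j" by simp
    have nz: "lam j \<noteq> 0"
      using assms(4)[OF ij(2)] by (simp add: is_mahler_eigenvalue_def)
    define e :: "nat \<Rightarrow> int" where "e a = (if a = i then 1 else if a = j then -1 else 0)" for a
    have "(\<Prod>a\<in>{1..d}. lam a powi e a) = (\<Prod>a\<in>{i, j}. lam a powi e a)"
      using ij by (intro prod.mono_neutral_right) (auto simp: e_def)
    also have "\<dots> = 1"
      using ij(4) nz by (simp add: e_def eq)
    finally have "\<forall>a\<in>{1..d}. e a = 0"
      using indep[of 0 e] by simp
    then have "e i = 0"
      using ij(1) by blast
    then show False by (simp add: e_def)
  qed
  have main: "algebraically_independent meromorphic_fls {1..d} ?x"
    using algebraically_independent_of_mahler_eigenvalues[OF assms(1) _ assms(3,4) indep] by simp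
  \<comment> \<open>Recovers the index of a function, so that the family can be indexed by its own
    values, as \<open>transcendence_degree\<close> requires.\<close>
  define h where "h = inv_into {1..d} ?x"
  have h: "h b \<in> {1..d}" "?x (h b) = b" if "b \<in> B" for b
    using that unfolding B_def h_def by (rule inv_into_into, rule f_inv_into_f)
  have hx: "h (?x i) = i" if "i \<in> {1..d}" for i
    unfolding h_def by (rule inv_into_f_f[OF inj that])
  have "algebraically_independent meromorphic_fls B (\<lambda>b. ?x (h b))"
  proof (rule algebraically_independent_of_mahler_eigenvalues[OF assms(1), where l = "\<lambda>b. lam (h b)"])
    show "finite B" by (simp add: B_def)
    fix n :: int and e assume "of_nat k powi n * (\<Prod>b\<in>B. lam (h b) powi e b) = 1"
    moreover have "(\<Prod>b\<in>B. lam (h b) powi e b) = (\<Prod>i\<in>{1..d}. lam i powi e (?x i))"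
      unfolding B_def by (subst prod.reindex[OF inj]) (auto intro!: prod.cong simp: hx)
    ultimately have "\<forall>i\<in>{1..d}. e (?x i) = 0"
      using indep[of n "\<lambda>i. e (?x i)"] by simp
    then show "\<forall>b\<in>B. e b = 0" by (auto simp: B_def)
  qed (use h(1) assms(3,4) in auto)
  then have indep_B: "algebraically_independent meromorphic_fls B (\<lambda>b. b)"
    by (rule algebraically_independent_cong[rotated]) (use h(2) in auto)
  have "transcendence_degree meromorphic_fls (field_adjoin meromorphic_fls B) = enat d"
    unfolding transcendence_degree_def
  \<comment> \<open>The dimension count bounds every independent set by \<open>d\<close>, and
    \<open>B\<close> attains the bound.\<close>
  proof (rule antisym)
    show "(SUP A \<in> {A. finite A \<and> A \<subseteq> field_adjoin meromorphic_fls B \<and>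
        algebraically_independent meromorphic_fls A (\<lambda>b. b)}. enat (card A)) \<le> enat d"
    proof (rule SUP_least)
      fix A assume "A \<in> {A. finite A \<and> A \<subseteq> field_adjoin meromorphic_fls B \<and>
        algebraically_independent meromorphic_fls A (\<lambda>b. b)}"
      then show "enat (card A) \<le> enat d"
        using algebraically_independent_card_le[OF is_subfield_meromorphic_fls, of "{1..d}" A ?x]
        by (simp add: B_def)
    qed
    have "card B = d"
      unfolding B_def using card_image[OF inj] by simp
    then show "enat d \<le> (SUP A \<in> {A. finite A \<and> A \<subseteq> field_adjoin meromorphic_fls B \<and>
        algebraically_independent meromorphic_fls A (\<lambda>b. b)}. enat (card A))"
      using indep_B field_adjoin_superset(2)[of B meromorphic_fls]
      by (intro SUP_upper2[of B]) (simp_all add: B_def)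
  qed
  moreover have "algebraically_independent rational_fls {1..d} ?x"
    by (rule algebraically_independent_subset[OF main rational_fls_subset_meromorphic_fls])
  ultimately show ?thesis
    by (simp add: K B_def)
qed

end
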